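(* Let $l\geq 1$ be a fixed integer. The function $$\psi(m_1)=(2m_1+1)\,l-2\binom{m_1+2}{4},$$ defined on the set of integers $m_1\geq 1$ satisfying $\binom{m_1+2}{3}\leq l$, is strictly increasing.
   Context: Convention: $\binom{m}{n}=0$ for integers $m<n$. (In the paper, $m_1$ is the exponent of the pure power of $x$ among the minimal generators of a $0$-dimensional Borel-fixed ideal of colength $l$ in $\mathbb{C}[x,y,z]$.) *)

theory Defs
  imports Main
begin

text \<open>
  The integers \<open>m \<ge> 1\<close> are represented by natural numbers, for which \<open>n choose k = 0\<close>
  whenever \<open>n < k\<close>.  The values are integers, so that the subtraction is not truncated.
\<close>

definition psi :: "nat \<Rightarrow> nat \<Rightarrow> int" where
  "psi l m = (2 * int m + 1) * int l - 2 * int ((m + 2) choose 4)"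

definition psi_domain :: "nat \<Rightarrow> nat set" where
  "psi_domain l = {m. m \<ge> 1 \<and> (m + 2) choose 3 \<le> l}"

end

theory Submission
  imports Defs
begin

text \<open>By Pascal's rule, the step from \<open>m\<close> to \<open>m + 1\<close> changes
  \<open>psi l\<close> by twice \<open>l - ((m + 2) choose 3)\<close> (\<open>psi_Suc\<close>).
  Since \<open>(m + 2) choose 3\<close> grows strictly with \<open>m\<close>
  (\<open>choose_3_less\<close>), the bound at \<open>n\<close> makes every step up to
  \<open>n\<close> positive, and \<open>psi_less\<close> chains these steps.\<close>

lemma psi_Suc: "psi l (Suc m) = psi l m + 2 * (int l - int ((m + 2) choose 3))"
proof -
  have "(Suc m + 2) choose 4 = ((m + 2) choose 3) + ((m + 2) choose 4)"
    by (simp add: eval_nat_numeral)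
  then show ?thesis
    unfolding psi_def by (simp add: algebra_simps)
qed

lemma choose_3_less: "(m + 2) choose 3 < (Suc m + 2) choose 3"
proof -
  have "(Suc m + 2) choose 3 = ((m + 2) choose 2) + ((m + 2) choose 3)"
    by (simp add: eval_nat_numeral)
  moreover have "(m + 2) choose 2 > 0"
    by (rule zero_less_binomial) simp
  ultimately show ?thesis by simp
qed

lemma psi_less:
  assumes "m < n" "(n + 2) choose 3 \<le> l"
  shows "psi l m < psi l n"
  using assms
proof (induction n)
  case (Suc n)
  \<comment> \<open>The bound at \<open>Suc n\<close> becomes strict at \<open>n\<close>. Strictness
    makes the last increment positive; the weak form is the premise of the induction
    hypothesis.\<close>
  have "(n + 2) choose 3 < l"
    using choose_3_less Suc.prems(2) by (rule less_le_trans)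
  then have "psi l n < psi l (Suc n)" and "m < n \<Longrightarrow> psi l m < psi l n"
    using Suc.IH by (simp_all add: psi_Suc)
  then show ?case
    using Suc.prems(1) by (auto simp: less_Suc_eq)
qed simp

theorem theorem2:
  fixes l :: nat
  assumes "l \<ge> 1"
  shows "strict_mono_on (psi_domain l) (psi l)"
  by (rule strict_mono_onI) (simp add: psi_domain_def psi_less)

end
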